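(* Let $Y$ be a Poisson random variable with parameter $\alpha>0$. Let $(Y_j)_{j\ge 1}$ be mutually independent copies of $Y$, and let $S_0=0$, $S_k=Y_1+\cdots+Y_k$ for $k\ge 1$. Then for all integers $n,k\ge 0$, $$E\big[\langle S_{k}\rangle_{n}\big]=B_{n}^{L}(\alpha k).$$
   Context: Rising factorial: $\langle x\rangle_0=1$, $\langle x\rangle_n=x(x+1)\cdots(x+n-1)$ for $n\ge 1$. Falling factorial: $(x)_0=1$, $(x)_n=x(x-1)\cdots(x-n+1)$ for $n\ge 1$. The unsigned Lah numbers $L(n,k)$ ($n\ge k\ge 0$) are defined by $\langle x\rangle_{n}=\sum_{k=0}^{n}L(n,k)(x)_{k}$. The Lah-Bell polynomials are $B_{n}^{L}(x)=\sum_{l=0}^{n}L(n,l)x^{l}$, $n\ge 0$. *)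

theory Defs
  imports "HOL-Probability.Probability"
begin

text \<open>The rising factorial is the library function \<^const>\<open>pochhammer\<close>.\<close>

definition falling_factorial :: "real \<Rightarrow> nat \<Rightarrow> real" where
  "falling_factorial x n = (\<Prod>i<n. x - real i)"

lemma falling_factorial_Suc:
  "falling_factorial x (Suc n) = falling_factorial x n * (x - real n)"
  by (simp add: falling_factorial_def)

lemma falling_factorial_of_nat_eq_0: "m < n \<Longrightarrow> falling_factorial (real m) n = 0"
  by (auto simp: falling_factorial_def)

lemma falling_factorial_of_nat_nonzero: "falling_factorial (real n) n \<noteq> 0"
  by (auto simp: falling_factorial_def)

text \<open>
  The unsigned Lah numbers are the connection coefficients from rising to falling factorials,
  set to 0 for \<open>k > n\<close>; existence and uniqueness are shown in \<open>ex1_lah\<close> below.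
\<close>

definition lah :: "nat \<Rightarrow> nat \<Rightarrow> real" where
  "lah n = (THE c. (\<forall>k>n. c k = 0) \<and>
     (\<forall>x. pochhammer x n = (\<Sum>k=0..n. c k * falling_factorial x k)))"

definition lah_bell :: "nat \<Rightarrow> real \<Rightarrow> real" where
  "lah_bell n x = (\<Sum>l=0..n. lah n l * x ^ l)"

lemma falling_factorial_coeffs_unique:
  assumes "\<And>x. (\<Sum>k=0..n. c k * falling_factorial x k) = (\<Sum>k=0..n. d k * falling_factorial x k)"
    and "m \<le> n"
  shows "c m = d m"
  using assms(2)
proof (induction m rule: less_induct)
  case (less m)
  have split: "(\<Sum>k=0..n. e k * falling_factorial (real m) k) =
      (\<Sum>k<m. e k * falling_factorial (real m) k) + e m * falling_factorial (real m) m" for e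
  proof -
    have "(\<Sum>k=0..n. e k * falling_factorial (real m) k) =
        (\<Sum>k\<in>{..<Suc m}. e k * falling_factorial (real m) k)"
      using less.prems
      by (intro sum.mono_neutral_right) (auto simp: falling_factorial_of_nat_eq_0)
    then show ?thesis by simp
  qed
  have "(\<Sum>k<m. c k * falling_factorial (real m) k) = (\<Sum>k<m. d k * falling_factorial (real m) k)"
    using less by (intro sum.cong) auto
  then show ?case
    using assms(1)[of "real m"] falling_factorial_of_nat_nonzero[of m] by (simp add: split)
qed

lemma ex_lah:
  "\<exists>c. (\<forall>k>n. c k = 0) \<and>
     (\<forall>x. pochhammer x n = (\<Sum>k=0..n. c k * falling_factorial x k))"
proof (induction n)
  case 0
  show ?case
    by (rule exI[of _ "\<lambda>k. if k = 0 then 1 else 0"]) (simp add: falling_factorial_def)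
next
  case (Suc n)
  then obtain c where c0: "\<And>k. k > n \<Longrightarrow> c k = 0"
    and c: "\<And>x. pochhammer x n = (\<Sum>k=0..n. c k * falling_factorial x k)"
    by blast
  define d where "d k = (if k = 0 then 0 else c (k - 1)) + (real k + real n) * c k" for k
  have "pochhammer x (Suc n) = (\<Sum>k=0..Suc n. d k * falling_factorial x k)" for x
  proof -
    have "pochhammer x (Suc n) = (\<Sum>k=0..n. c k * falling_factorial x k * (x + real n))"
      by (simp add: pochhammer_Suc c sum_distrib_right)
    also have "\<dots> = (\<Sum>k=0..n. c k * falling_factorial x (Suc k)) +
        (\<Sum>k=0..n. (real k + real n) * c k * falling_factorial x k)"
      unfolding sum.distrib[symmetric]
      by (intro sum.cong) (auto simp: falling_factorial_Suc algebra_simps)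
    also have "(\<Sum>k=0..n. c k * falling_factorial x (Suc k)) =
        (\<Sum>k=0..Suc n. (if k = 0 then 0 else c (k - 1)) * falling_factorial x k)"
      by (simp add: sum.atLeast0_atMost_Suc_shift del: sum.cl_ivl_Suc)
    also have "(\<Sum>k=0..n. (real k + real n) * c k * falling_factorial x k) =
        (\<Sum>k=0..Suc n. (real k + real n) * c k * falling_factorial x k)"
      by (simp add: c0)
    finally show ?thesis
      by (simp add: d_def sum.distrib[symmetric] distrib_right del: sum.cl_ivl_Suc)
  qed
  moreover have "\<forall>k>Suc n. d k = 0"
    by (auto simp: d_def c0)
  ultimately show ?case by blast
qed

lemma ex1_lah:
  "\<exists>!c. (\<forall>k>n. c k = 0) \<and>
     (\<forall>x. pochhammer x n = (\<Sum>k=0..n. c k * falling_factorial x k))"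
proof (rule ex_ex1I[OF ex_lah])
  fix c d
  assume c: "(\<forall>k>n. c k = 0) \<and>
      (\<forall>x. pochhammer x n = (\<Sum>k=0..n. c k * falling_factorial x k))"
    and d: "(\<forall>k>n. d k = 0) \<and>
      (\<forall>x. pochhammer x n = (\<Sum>k=0..n. d k * falling_factorial x k))"
  show "c = d"
  proof
    fix m
    show "c m = d m"
    proof (cases "m \<le> n")
      case True
      have "(\<Sum>k=0..n. c k * falling_factorial x k) = (\<Sum>k=0..n. d k * falling_factorial x k)" for x
        using c d by metis
      then show ?thesis using True by (rule falling_factorial_coeffs_unique)
    qed (use c d in auto)
  qed
qed

lemma lah_eq_0: "k > n \<Longrightarrow> lah n k = 0"
  and pochhammer_eq_sum_lah: "pochhammer x n = (\<Sum>k=0..n. lah n k * falling_factorial x k)"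
  using theI'[OF ex1_lah[of n]] unfolding lah_def by blast+

end

theory Submission
  imports Defs
begin

text \<open>
  The Poisson distribution with parameter \<open>r\<close> has factorial moments \<open>r\<^sup>n\<close>. By Vandermonde's identity,
  falling factorials are of binomial type, so for independent variables with factorial moments
  \<open>r\<^sup>n\<close> and \<open>s\<^sup>n\<close> the sum has factorial moments \<open>(r + s)\<^sup>n\<close>. Hence \<open>S\<^sub>k\<close> has factorial moments
  \<open>(\<alpha> k)\<^sup>n\<close>, and expanding the rising factorial in falling factorials turns these into the
  Lah-Bell polynomial.
\<close>

lemma falling_factorial_eq_gbinomial: "falling_factorial x n = fact n * (x gchoose n)"
  by (simp add: falling_factorial_def gbinomial_prod_rev lessThan_atLeast0)

lemma falling_factorial_add:
  "falling_factorial (x + y) n =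
    (\<Sum>i\<le>n. real (n choose i) * (falling_factorial x i * falling_factorial y (n - i)))"
proof -
  have "falling_factorial (x + y) n = (\<Sum>i\<le>n. fact n * ((x gchoose i) * (y gchoose (n - i))))"
    by (simp add: falling_factorial_eq_gbinomial gbinomial_Vandermonde[symmetric]
        sum_distrib_left atMost_atLeast0)
  \<comment> \<open>The factor n! splits as (n choose i) * i! * (n - i)!, and the last two
    factorials turn the generalized binomials back into falling factorials.\<close>
  also have "\<dots> = (\<Sum>i\<le>n. real (n choose i) * (falling_factorial x i * falling_factorial y (n - i)))"
    by (intro sum.cong) (auto simp: falling_factorial_eq_gbinomial binomial_fact)
  finally show ?thesis .
qed

lemma borel_measurable_falling_factorial [measurable]:
  "(\<lambda>x. falling_factorial x n) \<in> borel_measurable borel"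
  unfolding falling_factorial_def by measurable

lemma falling_factorial_of_nat:
  "n \<le> m \<Longrightarrow> falling_factorial (real m) n = fact m / fact (m - n)"
  by (simp add: falling_factorial_eq_gbinomial binomial_gbinomial[symmetric] binomial_fact)

lemma falling_factorial_of_nat_nonneg: "falling_factorial (real m) n \<ge> 0"
  by (cases "n \<le> m") (auto simp: falling_factorial_of_nat falling_factorial_of_nat_eq_0)

text \<open>In the series for the expectation the terms with m < n vanish. In the others the falling
  factorial cancels against the factorial in the Poisson weight, leaving r^n * exp (-r) times the
  exponential series.\<close>

lemma has_bochner_integral_poisson_falling_factorial:
  assumes "r > 0"
  shows "has_bochner_integral (measure_pmf (poisson_pmf r)) (\<lambda>m. falling_factorial (real m) n) (r ^ n)"
proof -
  let ?f = "\<lambda>m. pmf (poisson_pmf r) m * falling_factorial (real m) n"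
  have "(\<lambda>m. r ^ n * exp (-r) * (r ^ m / fact m)) sums (r ^ n * exp (-r) * exp r)"
    using exp_converges[of r] by (intro sums_mult) (simp add: divide_inverse mult.commute)
  moreover have "(\<lambda>m. r ^ n * exp (-r) * (r ^ m / fact m)) = (\<lambda>m. ?f (m + n))"
    using assms by (simp add: fun_eq_iff falling_factorial_of_nat power_add del: of_nat_add)
  moreover have "r ^ n * exp (-r) * exp r = r ^ n"
    by (simp add: exp_minus)
  moreover have "(\<Sum>m<n. ?f m) = 0"
    by (intro sum.neutral) (auto simp: falling_factorial_of_nat_eq_0)
  ultimately have sums: "?f sums (r ^ n)"
    using sums_iff_shift[of ?f n "r ^ n"] by simp
  \<comment> \<open>Integrability needs absolute convergence, which is plain convergence here
    because all terms are nonnegative.\<close>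
  have "integrable (count_space UNIV) ?f"
    using sums_summable[OF sums]
    by (simp add: integrable_count_space_nat_iff falling_factorial_of_nat_nonneg abs_mult)
  moreover have "integral\<^sup>L (count_space UNIV) ?f = r ^ n"
    using integral_count_space_nat[OF calculation] sums_unique[OF sums] by simp
  ultimately show ?thesis
    by (simp add: has_bochner_integral_iff measure_pmf_eq_density integrable_density integral_density)
qed

context prob_space
begin

text \<open>Expanding the falling factorial of the sum gives products of lower ones. Independence
  factors their expectations, and the binomial theorem reassembles the result. Since all orders up
  to n enter, the moments of \<open>X\<close> and \<open>Z\<close> are assumed for every
  order.\<close>

lemma has_bochner_integral_falling_factorial_add:
  assumes indep: "indep_var borel X borel Z"
    and X: "\<And>n. has_bochner_integral M (\<lambda>\<omega>. falling_factorial (X \<omega>) n) (r ^ n)"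
    and Z: "\<And>n. has_bochner_integral M (\<lambda>\<omega>. falling_factorial (Z \<omega>) n) (s ^ n)"
  shows "has_bochner_integral M (\<lambda>\<omega>. falling_factorial (X \<omega> + Z \<omega>) n) ((r + s) ^ n)"
proof -
  have "has_bochner_integral M (\<lambda>\<omega>. falling_factorial (X \<omega>) i * falling_factorial (Z \<omega>) j) (r ^ i * s ^ j)"
    for i j
  proof -
    have "indep_var borel (\<lambda>\<omega>. falling_factorial (X \<omega>) i) borel (\<lambda>\<omega>. falling_factorial (Z \<omega>) j)"
      using indep_var_compose[OF indep borel_measurable_falling_factorial[of i]
          borel_measurable_falling_factorial[of j]]
      by (simp add: comp_def)
    then show ?thesis
      using X[of i] Z[of j]
      by (simp add: has_bochner_integral_iff indep_var_integrable indep_var_lebesgue_integral)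
  qed
  then have "has_bochner_integral M
      (\<lambda>\<omega>. \<Sum>i\<le>n. real (n choose i) * (falling_factorial (X \<omega>) i * falling_factorial (Z \<omega>) (n - i)))
      (\<Sum>i\<le>n. real (n choose i) * (r ^ i * s ^ (n - i)))"
    by (intro has_bochner_integral_sum has_bochner_integral_mult_right)
  then show ?thesis
    by (simp add: falling_factorial_add binomial_ring mult.assoc)
qed

lemma has_bochner_integral_falling_factorial_sum:
  assumes "finite I"
    and "indep_vars (\<lambda>_. borel) X I"
    and "\<And>i n. i \<in> I \<Longrightarrow> has_bochner_integral M (\<lambda>\<omega>. falling_factorial (X i \<omega>) n) (r i ^ n)"
  shows "has_bochner_integral M (\<lambda>\<omega>. falling_factorial (\<Sum>i\<in>I. X i \<omega>) n) ((\<Sum>i\<in>I. r i) ^ n)"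
  using assms
\<comment> \<open>\<open>n\<close> is generalized because the addition lemma needs all factorial
  moments of the partial sum.\<close>
proof (induction I arbitrary: n rule: finite_induct)
  case empty
  show ?case
    \<comment> \<open>The empty sum is 0: for n = 0 both sides are 1, otherwise the factor with
      index 0 vanishes and so does 0^n.\<close>
    by (cases n) (auto simp: falling_factorial_def has_bochner_integral_iff prob_space prod.lessThan_Suc_shift)
next
  case (insert i I)
  have "indep_vars (\<lambda>_. borel) X I"
    using insert.prems(1) by (rule indep_vars_subset) auto
  then have "has_bochner_integral M (\<lambda>\<omega>. falling_factorial (\<Sum>i\<in>I. X i \<omega>) n) ((\<Sum>i\<in>I. r i) ^ n)" for n
    using insert.prems(2) by (intro insert.IH) auto
  moreover have "indep_var borel (X i) borel (\<lambda>\<omega>. \<Sum>i\<in>I. X i \<omega>)"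
    using insert by (intro indep_vars_sum) auto
  ultimately show ?case
    using insert by (simp add: has_bochner_integral_falling_factorial_add)
qed

end

theorem theorem2p12:
  fixes M :: "'a measure" and \<alpha> :: real
    and Y :: "'a \<Rightarrow> nat" and Ys :: "nat \<Rightarrow> 'a \<Rightarrow> nat"
    and n k :: nat
  assumes "prob_space M"
    and "\<alpha> > 0"
    and "Y \<in> measurable M (count_space UNIV)"
    and "distr M (count_space UNIV) Y = measure_pmf (poisson_pmf \<alpha>)"
    and "prob_space.indep_vars M (\<lambda>_. count_space UNIV) Ys {1..}"
    and "\<And>j. j \<ge> 1 \<Longrightarrow> distr M (count_space UNIV) (Ys j) = distr M (count_space UNIV) Y"
  defines "S \<equiv> \<lambda>k \<omega>. \<Sum>j=1..k. Ys j \<omega>"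
  shows "integrable M (\<lambda>\<omega>. pochhammer (real (S k \<omega>)) n) \<and>
    prob_space.expectation M (\<lambda>\<omega>. pochhammer (real (S k \<omega>)) n) = lah_bell n (\<alpha> * real k)"
proof -
  interpret prob_space M by fact
  have "indep_vars (\<lambda>_. count_space UNIV) Ys {1..k}"
    using assms(5) by (rule indep_vars_subset) auto
  \<comment> \<open>The counts are viewed as real variables, since the sum lemma is stated for the
    Borel space.\<close>
  then have indep: "indep_vars (\<lambda>_. borel) (\<lambda>j \<omega>. real (Ys j \<omega>)) {1..k}"
    by (rule indep_vars_compose2) auto
  have "has_bochner_integral M (\<lambda>\<omega>. falling_factorial (real (Ys j \<omega>)) l) (\<alpha> ^ l)" if "j \<in> {1..k}" for j l
  proof -
    have meas: "Ys j \<in> measurable M (count_space UNIV)"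
      using assms(5) that unfolding indep_vars_def2 by auto
    have "distr M (count_space UNIV) (Ys j) = measure_pmf (poisson_pmf \<alpha>)"
      using assms(4,6) that by simp
    then have "has_bochner_integral (distr M (count_space UNIV) (Ys j))
        (\<lambda>m. falling_factorial (real m) l) (\<alpha> ^ l)"
      using has_bochner_integral_poisson_falling_factorial assms(2) by simp
    then show ?thesis
      using meas by (simp add: has_bochner_integral_iff integrable_distr_eq integral_distr)
  qed
  \<comment> \<open>All parameters equal \<alpha>, so their sum over \<open>{1..k}\<close> is
    \<alpha> * k.\<close>
  from has_bochner_integral_falling_factorial_sum[OF _ indep this]
  have "has_bochner_integral M (\<lambda>\<omega>. falling_factorial (real (S k \<omega>)) l) ((\<alpha> * real k) ^ l)" for l
    by (simp add: S_def mult.commute)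
  then have "has_bochner_integral M
      (\<lambda>\<omega>. \<Sum>l=0..n. lah n l * falling_factorial (real (S k \<omega>)) l)
      (\<Sum>l=0..n. lah n l * (\<alpha> * real k) ^ l)"
    by (intro has_bochner_integral_sum has_bochner_integral_mult_right)
  then show ?thesis
    by (simp add: pochhammer_eq_sum_lah lah_bell_def has_bochner_integral_iff)
qed

end
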